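(* Let $R$ be a commutative ring with identity. Every weakly $J$-submodule of a $J$-presimplifiable $R$-module $M$ is a $J$-submodule of $M$.
   Context: Rings are commutative with identity and modules are unital. $J(R)$ is the Jacobson radical of $R$. For a submodule $N$ of an $R$-module $M$, $(N:M)=\{r\in R: rM\subseteq N\}$. $Z(M)=\{r\in R: rm=0 \text{ for some } 0\neq m\in M\}$. An $R$-module $M$ is $J$-presimplifiable if $Z(M)\subseteq (J(R)M:M)$. A proper submodule $N$ of $M$ is a $J$-submodule if whenever $r\in R$, $m\in M$ satisfy $rm\in N$ and $r\notin (J(R)M:M)$, then $m\in N$. A proper submodule $N$ of $M$ is a weakly $J$-submodule if whenever $r\in R$, $m\in M$ satisfy $0\neq rm\in N$ and $r\notin (J(R)M:M)$, then $m\in N$. *)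

theory Defs
  imports "HOL-Algebra.Module" "HOL-Algebra.Ideal"
begin

text \<open>
  The intersection is cut down to the carrier, so that the zero ring, which has no maximal
  ideals, is its own Jacobson radical.
\<close>

definition jacobson_radical :: "('a, 'r) ring_scheme \<Rightarrow> 'a set" where
  "jacobson_radical R = {r \<in> carrier R. \<forall>I. maximalideal I R \<longrightarrow> r \<in> I}"

text \<open>The product \<open>I M\<close>: the submodule generated by all \<open>a m\<close> with \<open>a \<in> I\<close> and \<open>m \<in> M\<close>.\<close>

definition ideal_smult ::
    "('a, 'r) ring_scheme \<Rightarrow> 'a set \<Rightarrow> ('a, 'b, 'm) module_scheme \<Rightarrow> 'b set" where
  "ideal_smult R I M =
     \<Inter> {N. submodule N R M \<and> (\<forall>a\<in>I. \<forall>m\<in>carrier M. a \<odot>\<^bsub>M\<^esub> m \<in> N)}"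

definition residual ::
    "('a, 'r) ring_scheme \<Rightarrow> 'b set \<Rightarrow> ('a, 'b, 'm) module_scheme \<Rightarrow> 'a set" where
  "residual R N M = {r \<in> carrier R. \<forall>m\<in>carrier M. r \<odot>\<^bsub>M\<^esub> m \<in> N}"

definition zero_divisors ::
    "('a, 'r) ring_scheme \<Rightarrow> ('a, 'b, 'm) module_scheme \<Rightarrow> 'a set" where
  "zero_divisors R M =
     {r \<in> carrier R. \<exists>m\<in>carrier M. m \<noteq> \<zero>\<^bsub>M\<^esub> \<and> r \<odot>\<^bsub>M\<^esub> m = \<zero>\<^bsub>M\<^esub>}"

definition J_presimplifiable ::
    "('a, 'r) ring_scheme \<Rightarrow> ('a, 'b, 'm) module_scheme \<Rightarrow> bool" where
  "J_presimplifiable R M \<longleftrightarrow>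
     zero_divisors R M \<subseteq> residual R (ideal_smult R (jacobson_radical R) M) M"

definition J_submodule ::
    "'b set \<Rightarrow> ('a, 'r) ring_scheme \<Rightarrow> ('a, 'b, 'm) module_scheme \<Rightarrow> bool" where
  "J_submodule N R M \<longleftrightarrow>
     submodule N R M \<and> N \<noteq> carrier M \<and>
     (\<forall>r\<in>carrier R. \<forall>m\<in>carrier M.
        r \<odot>\<^bsub>M\<^esub> m \<in> N \<and> r \<notin> residual R (ideal_smult R (jacobson_radical R) M) M
        \<longrightarrow> m \<in> N)"

definition weakly_J_submodule ::
    "'b set \<Rightarrow> ('a, 'r) ring_scheme \<Rightarrow> ('a, 'b, 'm) module_scheme \<Rightarrow> bool" where
  "weakly_J_submodule N R M \<longleftrightarrow>
     submodule N R M \<and> N \<noteq> carrier M \<and>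
     (\<forall>r\<in>carrier R. \<forall>m\<in>carrier M.
        r \<odot>\<^bsub>M\<^esub> m \<noteq> \<zero>\<^bsub>M\<^esub> \<and> r \<odot>\<^bsub>M\<^esub> m \<in> N \<and>
        r \<notin> residual R (ideal_smult R (jacobson_radical R) M) M
        \<longrightarrow> m \<in> N)"

end

theory Submission
  imports Defs
begin

text \<open>
  The two notions differ only on products \<open>r m = 0\<close>. If such an \<open>r\<close> lies outside
  \<open>(J(R)M : M)\<close>, then \<open>J\<close>-presimplifiability says that \<open>r\<close> is not a zero divisor on \<open>M\<close>,
  so \<open>m = 0\<close>, and \<open>0\<close> belongs to every submodule.
\<close>

theorem proposition10:
  fixes R :: "('a, 'r) ring_scheme"
    and M :: "('a, 'b, 'm) module_scheme"
    and N :: "'b set"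
  assumes "cring R"
    and "module R M"
    and "J_presimplifiable R M"
    and "weakly_J_submodule N R M"
  shows "J_submodule N R M"
proof -
  let ?K = "residual R (ideal_smult R (jacobson_radical R) M) M"
  have sub: "submodule N R M" and proper: "N \<noteq> carrier M"
    using assms(4) by (auto simp: weakly_J_submodule_def)
  have zero: "\<zero>\<^bsub>M\<^esub> \<in> N"
    using subgroup.one_closed[OF submodule.axioms(1)[OF sub]] by simp
  have "m \<in> N"
    if r: "r \<in> carrier R" "r \<notin> ?K" and m: "m \<in> carrier M" "r \<odot>\<^bsub>M\<^esub> m \<in> N" for r m
  proof (cases "r \<odot>\<^bsub>M\<^esub> m = \<zero>\<^bsub>M\<^esub>")
    case True
    have "r \<notin> zero_divisors R M"
      using assms(3) r(2) by (auto simp: J_presimplifiable_def)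
    with r(1) m(1) True have "m = \<zero>\<^bsub>M\<^esub>"
      by (auto simp: zero_divisors_def)
    with zero show ?thesis by simp
  next
    case False
    with assms(4) r m show ?thesis
      by (auto simp: weakly_J_submodule_def)
  qed
  with sub proper show ?thesis
    by (auto simp: J_submodule_def)
qed

end
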